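(* For all positive integers $n$, we have $c'_0(H(2,n)) = \mathrm{mc}'_0(H(2,n)) = \left\lceil \frac{n^2+n}{4} \right\rceil$.
   Context: Graphs are finite and simple. For positive integers $d,n$, the Hamming graph $H(d,n)$ is the $d$-fold Cartesian product of $K_n$: its vertices are the $d$-tuples with entries in $\{1,\dots,n\}$, two being adjacent iff they differ in exactly one coordinate. $\ell$-visibility Cops and Robbers on a graph $G$ ($\ell$ a nonnegative integer): a team of one or more cops and a single robber occupy vertices of $G$ (several cops may share a vertex). First the cops choose initial positions, then the robber, knowing them, chooses his. Thereafter the game proceeds in rounds, each a cop turn (each cop stays or moves to an adjacent vertex) followed by a robber turn (the robber stays or moves to an adjacent vertex). The robber always knows the cops' positions. The robber's position is unknown to the cops unless some cop is at distance at most $\ell$ from him; in that case the cops see the robber. (A cop sees a vertex if she is within distance $\ell$ of it; for $\ell=0$ this means she occupies it.) $c'_\ell(G)$ denotes the minimum number of cops having a strategy that guarantees that, within a finite number of rounds and regardless of how the robber plays (equivalently, even if he can anticipate the cops' moves), some cop sees the robber. Equivalently, it is the least $k$ for which $k$ cops can clean all vertices: after the initial placement the dirty vertices are those not within distance $\ell$ of a cop; in each cop turn, dirty vertices that are seen by cops in their new positions become clean; in each robber turn, every clean vertex that is adjacent to a dirty vertex and is not within distance $\ell$ of a cop becomes dirty. Let $\mathcal{S}_i$ denote the set of dirty vertices immediately after the $i$th cop turn. A cop strategy is weakly monotonic if $\mathcal{S}_{i+1} \subseteq \mathcal{S}_i$ for all $i$, i.e. any vertex that becomes recontaminated during a robber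 turn is cleaned again on the following cop turn. $\mathrm{mc}'_\ell(G)$ denotes the minimum number of cops needed to guarantee seeing the robber on $G$ (equivalently, to clean all vertices of $G$) using a weakly monotonic strategy. *)

theory Defs
  imports Complex_Main "Graph_Theory.Pair_Digraph" "Graph_Theory.Shortest_Path"
begin

text \<open>
  A finite simple graph is a \<^locale>\<open>pair_graph\<close>: a finite, loopless, symmetric digraph
  whose arcs are ordered pairs of vertices.
\<close>

section \<open>Hamming graphs\<close>

definition hamming_graph :: "nat \<Rightarrow> nat \<Rightarrow> nat list pair_pre_digraph" where
  "hamming_graph d n =
     (let V = {xs. length xs = d \<and> set xs \<subseteq> {1..n}} in
      \<lparr>pverts = V,
       parcs = {(xs, ys). xs \<in> V \<and> ys \<in> V \<and> card {i. i < d \<and> xs ! i \<noteq> ys ! i} = 1}\<rparr>)"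

lemma pair_graph_hamming_graph: "pair_graph (hamming_graph d n)"
proof -
  let ?V = "{xs::nat list. length xs = d \<and> set xs \<subseteq> {1..n}}"
  have V: "?V = {xs. set xs \<subseteq> {1..n} \<and> length xs = d}"
    by auto
  have fin: "finite ?V"
    unfolding V by (rule finite_lists_length_eq) simp
  have "parcs (hamming_graph d n) \<subseteq> ?V \<times> ?V"
    by (auto simp: hamming_graph_def Let_def)
  then have finarcs: "finite (parcs (hamming_graph d n))"
    by (rule finite_subset) (intro finite_cartesian_product fin)
  have "sym (parcs (hamming_graph d n))"
  proof (rule symI)
    fix xs ys assume "(xs, ys) \<in> parcs (hamming_graph d n)"
    moreover have "{i. i < d \<and> ys ! i \<noteq> xs ! i} = {i. i < d \<and> xs ! i \<noteq> ys ! i}"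
      by auto
    ultimately show "(ys, xs) \<in> parcs (hamming_graph d n)"
      by (simp add: hamming_graph_def Let_def)
  qed
  moreover have "(xs, ys) \<in> parcs (hamming_graph d n) \<Longrightarrow> xs \<in> pverts (hamming_graph d n) \<and>
      ys \<in> pverts (hamming_graph d n) \<and> xs \<noteq> ys" for xs ys
    by (auto simp: hamming_graph_def Let_def)
  moreover have "finite (pverts (hamming_graph d n))"
    using fin by (simp add: hamming_graph_def Let_def)
  ultimately show ?thesis
    using finarcs by unfold_locales (auto simp: symmetric_def)
qed

section \<open>The game with limited visibility\<close>

definition graph_dist :: "'a pair_pre_digraph \<Rightarrow> 'a \<Rightarrow> 'a \<Rightarrow> ereal" where
  "graph_dist G u v = wf_digraph.\<mu> (with_proj G) (\<lambda>_. 1) u v"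

definition legal_move :: "'a pair_pre_digraph \<Rightarrow> 'a \<Rightarrow> 'a \<Rightarrow> bool" where
  "legal_move G u v \<longleftrightarrow> u \<in> pverts G \<and> v \<in> pverts G \<and> (v = u \<or> u \<rightarrow>\<^bsub>G\<^esub> v)"

text \<open>
  Until the robber is seen, the cops receive no information about him, so a strategy of \<open>k\<close> cops
  is a predetermined sequence of positions: cop \<open>i < k\<close> starts at \<open>p 0 i\<close> and is at \<open>p t i\<close>
  after the cop turn of round \<open>t \<ge> 1\<close>.
\<close>

definition cop_strategy :: "'a pair_pre_digraph \<Rightarrow> nat \<Rightarrow> (nat \<Rightarrow> nat \<Rightarrow> 'a) \<Rightarrow> bool" where
  "cop_strategy G k p \<longleftrightarrow>
     (\<forall>i<k. p 0 i \<in> pverts G) \<and> (\<forall>t. \<forall>i<k. legal_move G (p t i) (p (Suc t) i))"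

text \<open>
  \<open>r 0\<close> is the robber's initial choice and \<open>r t\<close> his position after the robber turn of round
  \<open>t \<ge> 1\<close>. Quantifying over all such sequences once the cops' sequence is fixed covers robbers
  who anticipate the cops' moves.
\<close>

definition robber_play :: "'a pair_pre_digraph \<Rightarrow> (nat \<Rightarrow> 'a) \<Rightarrow> bool" where
  "robber_play G r \<longleftrightarrow> r 0 \<in> pverts G \<and> (\<forall>t. legal_move G (r t) (r (Suc t)))"

text \<open>The vertices seen when cop \<open>i < k\<close> is at \<open>c i\<close>.\<close>

definition seen :: "nat \<Rightarrow> 'a pair_pre_digraph \<Rightarrow> nat \<Rightarrow> (nat \<Rightarrow> 'a) \<Rightarrow> 'a set" where
  "seen l G k c = {v \<in> pverts G. \<exists>i<k. graph_dist G (c i) v \<le> ereal (real l)}"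

text \<open>
  The robber can be seen on being placed or after a robber turn (first disjunct), or after the
  cop turn of round \<open>Suc t\<close>, when he is still at \<open>r t\<close> (second disjunct).
\<close>

definition robber_seen ::
  "nat \<Rightarrow> 'a pair_pre_digraph \<Rightarrow> nat \<Rightarrow> (nat \<Rightarrow> nat \<Rightarrow> 'a) \<Rightarrow> (nat \<Rightarrow> 'a) \<Rightarrow> nat \<Rightarrow> bool" where
  "robber_seen l G k p r N \<longleftrightarrow>
     (\<exists>t\<le>N. r t \<in> seen l G k (p t)) \<or> (\<exists>t<N. r t \<in> seen l G k (p (Suc t)))"

definition winning_strategy ::
  "nat \<Rightarrow> 'a pair_pre_digraph \<Rightarrow> nat \<Rightarrow> (nat \<Rightarrow> nat \<Rightarrow> 'a) \<Rightarrow> bool" where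
  "winning_strategy l G k p \<longleftrightarrow>
     cop_strategy G k p \<and> (\<exists>N. \<forall>r. robber_play G r \<longrightarrow> robber_seen l G k p r N)"

definition vis_cop_number :: "nat \<Rightarrow> 'a pair_pre_digraph \<Rightarrow> nat" where
  "vis_cop_number l G = (LEAST k. 1 \<le> k \<and> (\<exists>p. winning_strategy l G k p))"

section \<open>Dirty vertices and weak monotonicity\<close>

text \<open>The dirty set after a robber turn, from the dirty set \<open>S\<close> before it and cops at \<open>c\<close>.\<close>

definition recontaminate ::
  "nat \<Rightarrow> 'a pair_pre_digraph \<Rightarrow> nat \<Rightarrow> (nat \<Rightarrow> 'a) \<Rightarrow> 'a set \<Rightarrow> 'a set" where
  "recontaminate l G k c S = S \<union> {v \<in> pverts G - seen l G k c. \<exists>u\<in>S. u \<rightarrow>\<^bsub>G\<^esub> v}"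

text \<open>
  \<open>dirty l G k p i\<close> is the dirty set immediately after the \<open>i\<close>-th cop turn; turn \<open>0\<close> is the initial
  placement. There is no robber move between placement and turn \<open>1\<close>, but applying
  \<open>recontaminate\<close> to the initial dirty set has no effect, as that set already contains every unseen
  vertex. So \<open>i = 0\<close> needs no separate treatment, and
  \<open>dirty l G k p 1 \<subseteq> dirty l G k p 0\<close> always holds.
\<close>

primrec dirty ::
  "nat \<Rightarrow> 'a pair_pre_digraph \<Rightarrow> nat \<Rightarrow> (nat \<Rightarrow> nat \<Rightarrow> 'a) \<Rightarrow> nat \<Rightarrow> 'a set" where
  "dirty l G k p 0 = pverts G - seen l G k (p 0)"
| "dirty l G k p (Suc i) =
     recontaminate l G k (p i) (dirty l G k p i) - seen l G k (p (Suc i))"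

definition weakly_monotonic ::
  "nat \<Rightarrow> 'a pair_pre_digraph \<Rightarrow> nat \<Rightarrow> (nat \<Rightarrow> nat \<Rightarrow> 'a) \<Rightarrow> bool" where
  "weakly_monotonic l G k p \<longleftrightarrow> (\<forall>i. dirty l G k p (Suc i) \<subseteq> dirty l G k p i)"

definition mono_vis_cop_number :: "nat \<Rightarrow> 'a pair_pre_digraph \<Rightarrow> nat" where
  "mono_vis_cop_number l G =
     (LEAST k. 1 \<le> k \<and> (\<exists>p. winning_strategy l G k p \<and> weakly_monotonic l G k p))"

section \<open>Winning means cleaning the graph\<close>

lemma recontaminate_initial:
  "recontaminate l G k (p 0) (dirty l G k p 0) = dirty l G k p 0"
  by (auto simp: recontaminate_def)

lemma dirty_one_subset: "dirty l G k p 1 \<subseteq> dirty l G k p 0"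
  unfolding One_nat_def dirty.simps(2) recontaminate_initial by auto

lemma dirty_not_seen: "dirty l G k p i \<subseteq> pverts G - seen l G k (p i)"
  by (induction i) (auto simp: recontaminate_def)

lemma dirty_trajectory:
  assumes "robber_play G r" "\<not> robber_seen l G k p r N"
  shows "r N \<in> recontaminate l G k (p N) (dirty l G k p N)"
  using assms(2)
proof (induction N)
  case 0
  then show ?case
    using assms(1) by (auto simp: robber_play_def robber_seen_def recontaminate_def)
next
  case (Suc N)
  from Suc.prems have "\<not> robber_seen l G k p r N"
    by (auto simp: robber_seen_def)
  with Suc.IH have "r N \<in> recontaminate l G k (p N) (dirty l G k p N)" .
  moreover have "r N \<notin> seen l G k (p (Suc N))" "r (Suc N) \<notin> seen l G k (p (Suc N))"
    using Suc.prems by (auto simp: robber_seen_def)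
  ultimately have d: "r N \<in> dirty l G k p (Suc N)" and
    v: "r (Suc N) \<notin> seen l G k (p (Suc N))"
    by simp_all
  have "r (Suc N) \<in> pverts G" "r (Suc N) = r N \<or> r N \<rightarrow>\<^bsub>G\<^esub> r (Suc N)"
    using assms(1) by (auto simp: robber_play_def legal_move_def)
  with d v show ?case
    by (auto simp: recontaminate_def simp del: dirty.simps)
qed

lemma trajectory_of_dirty:
  assumes "v \<in> recontaminate l G k (p N) (dirty l G k p N)"
  shows "\<exists>r. robber_play G r \<and> \<not> robber_seen l G k p r N \<and> (\<forall>t\<ge>N. r t = v)"
  using assms
proof (induction N arbitrary: v)
  case 0
  then have "v \<in> pverts G - seen l G k (p 0)"
    by (auto simp: recontaminate_def)
  then show ?case
    by (intro exI[of _ "\<lambda>_. v"]) (auto simp: robber_play_def legal_move_def robber_seen_def)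
next
  case (Suc N)
  have v: "v \<in> pverts G" "v \<notin> seen l G k (p (Suc N))"
    using Suc.prems dirty_not_seen[of l G k p "Suc N"] by (auto simp: recontaminate_def)
  obtain u where u: "u \<in> dirty l G k p (Suc N)" "v = u \<or> u \<rightarrow>\<^bsub>G\<^esub> v"
    using Suc.prems by (auto simp: recontaminate_def)
  then have "u \<in> recontaminate l G k (p N) (dirty l G k p N)" "u \<notin> seen l G k (p (Suc N))"
    by auto
  with Suc.IH obtain r where r: "robber_play G r" "\<not> robber_seen l G k p r N" "\<forall>t\<ge>N. r t = u"
    by blast
  let ?r = "\<lambda>t. if t \<le> N then r t else v"
  have "robber_play G ?r"
    unfolding robber_play_def
  proof (intro conjI allI)
    show "?r 0 \<in> pverts G"
      using r(1) by (auto simp: robber_play_def)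
    fix t
    have "legal_move G (r t) (r (Suc t))"
      using r(1) by (auto simp: robber_play_def)
    then show "legal_move G (?r t) (?r (Suc t))"
      using r(3) u(2) v(1)
      by (cases "t = N") (auto simp: legal_move_def)
  qed
  moreover have "\<not> robber_seen l G k p ?r (Suc N)"
  proof -
    have "r t \<notin> seen l G k (p (Suc t))" if "t \<le> N" for t
      using that r(2,3) \<open>u \<notin> seen l G k (p (Suc N))\<close>
      by (cases "t = N") (auto simp: robber_seen_def)
    then show ?thesis
      using r(2) v(2) by (auto simp: robber_seen_def le_Suc_eq less_Suc_eq)
  qed
  ultimately show ?case
    by (intro exI[of _ ?r]) auto
qed

theorem winning_strategy_iff_clean:
  "winning_strategy l G k p \<longleftrightarrow> cop_strategy G k p \<and> (\<exists>N. dirty l G k p N = {})"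
proof -
  have empty: "recontaminate l G k c S = {} \<longleftrightarrow> S = {}" for c and S :: "'a set"
    by (auto simp: recontaminate_def)
  have "(\<forall>r. robber_play G r \<longrightarrow> robber_seen l G k p r N) \<longleftrightarrow> dirty l G k p N = {}" for N
    using dirty_trajectory[of G _ l k p N] trajectory_of_dirty[of _ l G k p N]
      empty[of "p N" "dirty l G k p N"] by blast
  then show ?thesis
    by (simp add: winning_strategy_def)
qed

end

theory Submission
  imports Defs
begin

text \<open>
  For zero visibility a cop sees only the vertex that she occupies, so a cop turn from positions
  \<open>A\<close> to positions \<open>B\<close> turns the clean set \<open>C\<close> into \<open>(C - inner boundary of C) \<union> A \<union> B\<close>
  (\<open>clean_Suc\<close>). The graph is the \<open>n \<times> n\<close> rook's graph, and a cell is in the interior of \<open>C\<close> iff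
  its whole row and its whole column are clean.

  \<^bold>\<open>Lower bound.\<close> Let \<open>x\<close> rows and \<open>y\<close> columns be entirely clean. In the end \<open>x + y = 2 n\<close>;
  consider the first cop turn that lifts this number from \<open>x' + y' < n\<close> to \<open>x + y \<ge> n\<close>. (If the
  initial placement does so, put \<open>x' = y' = 0\<close>.) After this turn at least \<open>n (x + y) - x y\<close>
  cells are clean. At most \<open>x' y'\<close> of them were interior before, and all others carry a cop
  before or after the turn, so \<open>n (x + y) - x y - x' y' \<le> 2 k\<close>. Estimating both products by the
  squares of the sums gives \<open>2 k \<ge> (2 n\<^sup>2 + 2 n - 1) / 4\<close>, and integrality turns this into \<open>4 k
  \<ge> n\<^sup>2 + n\<close> (\<open>crossing_inequality\<close>, \<open>cop_number_lower_bound\<close>).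

  \<^bold>\<open>Upper bound.\<close> One cop can hold two cells of a common line by stepping to and fro between
  them: dirt that enters one of the cells while she is on the other is removed at once. So \<open>k\<close>
  cops can hold \<open>2 k\<close> cells, and the clean set is stable as long as they hold its inner
  boundary. A cop whose two cells are interior can be given a new pair; she walks there through
  clean cells (\<open>guarded_move\<close>). A clean cell that gets dirty in a robber turn is always cleaned
  in the next cop turn, so these strategies are weakly monotonic.

  Write \<open>n = 4 h + s\<close> with \<open>s \<le> 3\<close> and divide the board into \<open>2 h\<close> upper rows, a strip of \<open>s\<close>
  rows, and \<open>2 h\<close> lower rows. The \<open>n h\<close> vertical pairs of the upper rows are held from the
  start, and \<open>h\<close> further cops clean the lower part of column 0. Whenever a column is entirely
  clean, the \<open>h\<close> cops of its upper part are free and clean the lower part of the next column: a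
  conveyor that needs \<open>h (n + 1)\<close> cops in total (\<open>conveyor\<close>). The strip has \<open>h + 1\<close> cops for
  each of its rows; nearly all of them hold its left half while the first half of the columns is
  cleaned. Then the \<open>h\<close> free cops of the conveyor help to complete the row, whose left part
  thereby becomes interior; the row's own cops take over its right part and release the helpers
  (\<open>fill_row\<close>). After all strip rows are complete the conveyor runs to the end. The number of
  cops is \<open>h (n + 1) + s (h + 1)\<close>, which is \<open>\<lceil>(n\<^sup>2 + n) / 4\<rceil>\<close> in each of the four cases for \<open>s\<close>
  (\<open>ceiling_quarter_eq\<close>). For \<open>s = 3\<close> the cells to be held in the middle of the process number
  exactly \<open>2 k\<close>, so no cop may waste a cell; there some pairs are vertical and move on by
  keeping one of their cells (\<open>board_cleared_if_strip_eq_3\<close>).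
\<close>

section \<open>Cleaning with zero visibility\<close>

definition inner_boundary :: "'a pair_pre_digraph \<Rightarrow> 'a set \<Rightarrow> 'a set" where
  "inner_boundary G C = {v \<in> C. \<exists>u \<in> pverts G - C. u \<rightarrow>\<^bsub>G\<^esub> v}"

definition clean :: "nat \<Rightarrow> 'a pair_pre_digraph \<Rightarrow> nat \<Rightarrow> (nat \<Rightarrow> nat \<Rightarrow> 'a) \<Rightarrow> nat \<Rightarrow> 'a set" where
  "clean l G k p i = pverts G - dirty l G k p i"

text \<open>
  The distance is an infimum over walks, so positivity needs that a walk between distinct
  vertices has length at least one, uniformly.
\<close>

lemma graph_dist_le_zero_iff:
  assumes "pair_wf_digraph G" "u \<in> pverts G"
  shows "graph_dist G u v \<le> 0 \<longleftrightarrow> u = v"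
proof -
  interpret pair_wf_digraph G by fact
  have cost: "awalk_cost (\<lambda>_. 1) p = real (length p)" for p :: "('a \<times> 'a) list"
    by (induction p) (auto simp: awalk_cost_def)
  show ?thesis
  proof
    assume "graph_dist G u v \<le> 0"
    show "u = v"
    proof (rule ccontr)
      assume "u \<noteq> v"
      have "1 \<le> \<mu> (\<lambda>_. 1) u v"
        unfolding \<mu>_def
      proof (rule INF_greatest)
        fix p assume "p \<in> {p. awalk u p v}"
        with \<open>u \<noteq> v\<close> have "p \<noteq> []" by (auto simp: awalk_Nil_iff)
        then have "1 \<le> real (length p)" by (cases p) auto
        then show "1 \<le> ereal (awalk_cost (\<lambda>_. 1) p)"
          by (simp add: cost one_ereal_def)
      qed
      also have "\<dots> \<le> 0" using \<open>graph_dist G u v \<le> 0\<close> unfolding graph_dist_def .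
      finally show False by simp
    qed
  next
    assume "u = v"
    with assms have "awalk u [] v" by (simp add: awalk_Nil_iff)
    from min_cost_le_walk_cost[OF this, of "\<lambda>_. 1"]
    show "graph_dist G u v \<le> 0" by (simp add: graph_dist_def cost zero_ereal_def)
  qed
qed

lemma seen_zero:
  assumes "pair_wf_digraph G" "\<And>i. i < k \<Longrightarrow> c i \<in> pverts G"
  shows "seen 0 G k c = c ` {..<k}"
  using assms graph_dist_le_zero_iff[OF assms(1)] by (auto simp: seen_def zero_ereal_def[symmetric])

lemma cop_strategy_in_verts:
  "cop_strategy G k p \<Longrightarrow> i < k \<Longrightarrow> p t i \<in> pverts G"
  by (cases t) (auto simp: cop_strategy_def legal_move_def)

lemma clean_0:
  assumes "pair_wf_digraph G" "cop_strategy G k p"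
  shows "clean 0 G k p 0 = p 0 ` {..<k}"
  using cop_strategy_in_verts[OF assms(2)] seen_zero[OF assms(1), of k "p 0"]
  by (auto simp: clean_def)

text \<open>
  This identity carries both bounds: a clean vertex is lost exactly if it has a dirty neighbour and
  carries a cop neither before nor after the cop turn.
\<close>

lemma clean_Suc:
  assumes "pair_wf_digraph G" "cop_strategy G k p"
  shows "clean 0 G k p (Suc i) =
    (clean 0 G k p i - inner_boundary G (clean 0 G k p i)) \<union> p i ` {..<k} \<union> p (Suc i) ` {..<k}"
proof -
  have V: "p t j \<in> pverts G" if "j < k" for t j
    using cop_strategy_in_verts[OF assms(2) that] .
  have seen: "seen 0 G k (p t) = p t ` {..<k}" for t
    by (rule seen_zero[OF assms(1)]) (rule V)
  have sub: "p i ` {..<k} \<subseteq> clean 0 G k p i" "dirty 0 G k p i \<subseteq> pverts G"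
    using dirty_not_seen[of 0 G k p i] V[of _ i] by (auto simp: clean_def seen)
  then show ?thesis
    using V[of _ "Suc i"]
    by (auto simp: clean_def recontaminate_def inner_boundary_def seen)
qed

text \<open>
  The pairs (clean set, cop positions) that a team can reach without ever losing a clean vertex. The
  premise on the inner boundary says that all vertices that are at risk in the robber turn carry a
  cop before or after the next cop turn. The cops are indexed by an arbitrary set, so that a strategy
  may give them descriptive names.
\<close>

inductive reachable_state :: "'a pair_pre_digraph \<Rightarrow> 'c set \<Rightarrow> 'a set \<Rightarrow> ('c \<Rightarrow> 'a) \<Rightarrow> bool"
  for G :: "'a pair_pre_digraph" and Q :: "'c set" where
  start: "a ` Q \<subseteq> pverts G \<Longrightarrow> reachable_state G Q (a ` Q) a"
| turn: "reachable_state G Q C a \<Longrightarrow> (\<And>q. q \<in> Q \<Longrightarrow> legal_move G (a q) (b q)) \<Longrightarrow>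
    inner_boundary G C \<subseteq> a ` Q \<union> b ` Q \<Longrightarrow> reachable_state G Q (C \<union> b ` Q) b"

lemma dirty_cong:
  assumes "\<And>t. t \<le> i \<Longrightarrow> p t = p' t"
  shows "dirty l G k p i = dirty l G k p' i"
  using assms by (induction i) auto

lemma reachable_state_subset:
  "reachable_state G Q C a \<Longrightarrow> a ` Q \<subseteq> C \<and> C \<subseteq> pverts G"
  by (induction rule: reachable_state.induct) (auto simp: legal_move_def)

text \<open>
  The sequence of positions is prolonged by one cop turn at a time. It is kept constant after the last
  turn because a strategy is an infinite sequence of positions.
\<close>

lemma strategy_of_reachable_state:
  assumes "pair_wf_digraph G" "bij_betw f {..<k} Q" "reachable_state G Q C a"
  shows "\<exists>p T. cop_strategy G k p \<and> (\<forall>t\<ge>T. p t = a \<circ> f) \<and> clean 0 G k p T = C \<and>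
    (\<forall>t<T. clean 0 G k p t \<subseteq> clean 0 G k p (Suc t))"
  using assms(3)
proof (induction rule: reachable_state.induct)
  case (start a)
  have fQ: "f ` {..<k} = Q" using assms(2) by (simp add: bij_betw_def)
  define p where "p = (\<lambda>_ :: nat. a \<circ> f)"
  have cs: "cop_strategy G k p"
    using start fQ by (auto simp: p_def cop_strategy_def legal_move_def)
  have p_eq: "\<forall>t. p t = a \<circ> f" by (simp add: p_def)
  have "clean 0 G k p 0 = a ` Q"
    unfolding clean_0[OF assms(1) cs] fQ[symmetric] by (auto simp: p_eq)
  with cs p_eq show ?case by blast
next
  case (turn C a b)
  have fQ: "f ` {..<k} = Q" using assms(2) by (simp add: bij_betw_def)
  from turn.IH obtain p T where p: "cop_strategy G k p" "\<forall>t\<ge>T. p t = a \<circ> f"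
    "clean 0 G k p T = C" "\<forall>t<T. clean 0 G k p t \<subseteq> clean 0 G k p (Suc t)" by blast
  define p' where "p' = (\<lambda>t. if t \<le> T then p t else b \<circ> f)"
  have legal: "legal_move G (a (f i)) (b (f i))" if "i < k" for i
    using turn.hyps(2) that fQ by auto
  have p'_eq: "p' t = p t" if "t \<le> T" for t using that by (simp add: p'_def)
  have cs: "cop_strategy G k p'"
    unfolding cop_strategy_def
  proof (intro conjI allI impI)
    show "p' 0 i \<in> pverts G" if "i < k" for i
      using p(1) that by (simp add: p'_def cop_strategy_def)
    show "legal_move G (p' t i) (p' (Suc t) i)" if "i < k" for t i
    proof -
      consider "Suc t \<le> T" | "t = T" | "t > T" by linarith
      then show ?thesis
      proof cases
        case 1 then show ?thesis using p(1) that by (simp add: p'_def cop_strategy_def)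
      next
        case 2 then show ?thesis using p(2) legal[OF that] by (simp add: p'_def)
      next
        case 3 then show ?thesis using legal[OF that] by (simp add: p'_def legal_move_def)
      qed
    qed
  qed
  have clean_eq: "clean 0 G k p' t = clean 0 G k p t" if "t \<le> T" for t
    unfolding clean_def using dirty_cong[of t p' p] p'_eq that by simp
  have im: "p' T ` {..<k} = a ` Q" "p' (Suc T) ` {..<k} = b ` Q"
    using p(2) unfolding fQ[symmetric] by (auto simp: p'_def)
  have "a ` Q \<subseteq> C" using reachable_state_subset[OF turn.hyps(1)] by simp
  with turn.hyps(3) have last: "clean 0 G k p' (Suc T) = C \<union> b ` Q"
    unfolding clean_Suc[OF assms(1) cs] im clean_eq[OF order_refl] p(3) by auto
  have "clean 0 G k p' t \<subseteq> clean 0 G k p' (Suc t)" if "t < Suc T" for t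
  proof (cases "t = T")
    case True then show ?thesis using last p(3) clean_eq[of T] by auto
  next
    case False then show ?thesis using that clean_eq[of t] clean_eq[of "Suc t"] p(4) by simp
  qed
  with cs last show ?case
    by (intro exI[of _ p'] exI[of _ "Suc T"]) (auto simp: p'_def)
qed

lemma winning_of_reachable_state:
  assumes "pair_wf_digraph G" "finite Q" "reachable_state G Q (pverts G) a"
  shows "\<exists>p. winning_strategy 0 G (card Q) p \<and> weakly_monotonic 0 G (card Q) p"
proof -
  obtain f where f: "bij_betw f {..<card Q} Q"
    using ex_bij_betw_nat_finite[OF assms(2)] by (auto simp: atLeast0LessThan)
  obtain p T where p: "cop_strategy G (card Q) p" "clean 0 G (card Q) p T = pverts G"
    "\<forall>t<T. clean 0 G (card Q) p t \<subseteq> clean 0 G (card Q) p (Suc t)"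
    using strategy_of_reachable_state[OF assms(1) f assms(3)] by blast
  have dV: "dirty 0 G (card Q) p t \<subseteq> pverts G" for t
    using dirty_not_seen[of 0 G "card Q" p t] by auto
  have empty: "dirty 0 G (card Q) p t = {}" if "t \<ge> T" for t
    using that
  proof (induction rule: dec_induct)
    case base
    then show ?case using p(2) dV[of T] by (auto simp: clean_def)
  next
    case (step t)
    then show ?case by (simp add: recontaminate_def)
  qed
  have "dirty 0 G (card Q) p (Suc t) \<subseteq> dirty 0 G (card Q) p t" for t
  proof (cases "t < T")
    case True
    then show ?thesis using p(3) dV[of "Suc t"] unfolding clean_def by blast
  next
    case False
    then show ?thesis using empty[of "Suc t"] by (simp del: dirty.simps)
  qed
  then show ?thesis
    using p(1) empty[of T] unfolding winning_strategy_iff_clean weakly_monotonic_def by blast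
qed

section \<open>Holding a clean set with pairs of vertices\<close>

text \<open>
  Cop \<open>q\<close> steps to and fro between \<open>a q\<close> and \<open>b q\<close>, all cops being at their \<open>a\<close>-vertices at the same
  time. The actual clean set \<open>C\<close> depends on the history; \<open>X\<close> is only a lower bound for it, which is
  all that is needed to see that a vertex is interior.
\<close>

definition guarded ::
  "'a pair_pre_digraph \<Rightarrow> 'c set \<Rightarrow> ('c \<Rightarrow> 'a) \<Rightarrow> ('c \<Rightarrow> 'a) \<Rightarrow> 'a set \<Rightarrow> bool" where
  "guarded G Q a b X \<longleftrightarrow> (\<exists>C. reachable_state G Q C a \<and> X \<union> b ` Q \<subseteq> C \<and>
     inner_boundary G C \<subseteq> a ` Q \<union> b ` Q \<and> (\<forall>q\<in>Q. legal_move G (a q) (b q)))"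

definition enclosed :: "'a pair_pre_digraph \<Rightarrow> 'a set \<Rightarrow> 'a \<Rightarrow> bool" where
  "enclosed G X v \<longleftrightarrow> (\<forall>u. v \<rightarrow>\<^bsub>G\<^esub> u \<longrightarrow> u \<in> X)"

text \<open>
  A vertex that need not be held by the cops outside \<open>S\<close>: it cannot get dirty, or the cops in \<open>S\<close>,
  who keep their pairs, hold it.
\<close>

definition dispensable ::
  "'a pair_pre_digraph \<Rightarrow> 'c set \<Rightarrow> ('c \<Rightarrow> 'a) \<Rightarrow> ('c \<Rightarrow> 'a) \<Rightarrow> 'a set \<Rightarrow> 'a \<Rightarrow> bool" where
  "dispensable G S a b X v \<longleftrightarrow> enclosed G X v \<or> v \<in> a ` S \<union> b ` S"

lemma (in pair_graph) legal_move_sym: "legal_move G u v \<Longrightarrow> legal_move G v u"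
  using sym_arcs by (auto simp: legal_move_def symmetric_def dest: symD)

lemma inner_boundary_Un: "inner_boundary G (C \<union> D) \<subseteq> inner_boundary G C \<union> D"
  by (auto simp: inner_boundary_def)

lemma (in pair_graph) guarded_start:
  assumes "\<And>q. q \<in> Q \<Longrightarrow> legal_move G (a q) (b q)"
  shows "guarded G Q a b (a ` Q \<union> b ` Q)"
proof -
  have "reachable_state G Q (a ` Q) a"
    using assms by (intro reachable_state.start) (auto simp: legal_move_def)
  then have "reachable_state G Q (a ` Q \<union> b ` Q) b"
    by (rule reachable_state.turn) (auto simp: assms inner_boundary_def)
  then have "reachable_state G Q ((a ` Q \<union> b ` Q) \<union> a ` Q) a"
    by (rule reachable_state.turn) (auto simp: assms inner_boundary_def legal_move_sym)
  then show ?thesis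
    using assms unfolding guarded_def by (intro exI conjI) (auto simp: inner_boundary_def)
qed

text \<open>
  Many cops change their pairs at the same time, in one of two ways. A cop both of whose vertices are
  dispensable walks through a clean vertex \<open>w\<close> to her new pair. A cop for whom only \<open>a q\<close> is dispensable
  slides: she keeps \<open>b q\<close> and exchanges \<open>a q\<close> for another neighbour of \<open>b q\<close>. All this fits into
  four cop turns \<open>a \<rightarrow> w \<rightarrow> a' \<rightarrow> b' \<rightarrow> a'\<close>, where the cops who stay and those who slide use
  \<open>w = b\<close>. A vertex of the old inner boundary is held by a cop who stays or
  is the \<open>w = b = b'\<close> of a cop who slides, hence it is occupied in any two consecutive phases; the
  new clean vertices belong to \<open>a'\<close> or \<open>b'\<close>, which are occupied alternately from then on.
\<close>

lemma (in pair_graph) guarded_move: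
  fixes a b a' b' :: "'c \<Rightarrow> 'a"
  assumes "guarded G Q a b X"
    and "S \<subseteq> Q" "\<And>q. q \<in> S \<Longrightarrow> a' q = a q \<and> b' q = b q"
    and moves: "\<And>q. q \<in> Q - S \<Longrightarrow> dispensable G S a b X (a q) \<and>
      (dispensable G S a b X (b q) \<and> legal_move G (a' q) (b' q) \<and>
          (\<exists>w\<in>X. legal_move G (a q) w \<and> legal_move G w (a' q)) \<or>
       b' q = b q \<and> legal_move G (b q) (a' q))"
  shows "guarded G Q a' b' (X \<union> a' ` Q \<union> b' ` Q)"
proof -
  from assms(1) obtain C where C: "reachable_state G Q C a" "X \<subseteq> C" "b ` Q \<subseteq> C"
    "inner_boundary G C \<subseteq> a ` Q \<union> b ` Q" and ab: "\<And>q. q \<in> Q \<Longrightarrow> legal_move G (a q) (b q)"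
    unfolding guarded_def by blast
  have enc: "v \<notin> inner_boundary G C" if "enclosed G X v" for v
    using that C(2) sym_arcs by (auto simp: enclosed_def inner_boundary_def symmetric_def dest: symD)
  \<comment> \<open>the intermediate stop of each cop; a boundary vertex that only a sliding cop holds must be both her \<open>w\<close> and her \<open>b'\<close>\<close>
  have "\<exists>w\<in>C. legal_move G (a q) w \<and> legal_move G w (a' q) \<and> legal_move G (a' q) (b' q) \<and>
      (\<forall>v\<in>inner_boundary G C. v \<in> {a q, b q} \<longrightarrow> v \<in> a ` S \<union> b ` S \<or> (w = v \<and> b' q = v)) \<and>
      (q \<in> S \<longrightarrow> w = b q)" if "q \<in> Q" for q
  proof (cases "q \<in> S")
    case True
    then show ?thesis
      using assms(3)[OF True] C(3) ab[OF that] that legal_move_sym[OF ab[OF that]]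
      by (intro bexI[of _ "b q"]) auto
  next
    case False
    with that have q: "q \<in> Q - S" by simp
    from moves[OF this] consider
        w where "dispensable G S a b X (a q)" "dispensable G S a b X (b q)" "legal_move G (a' q) (b' q)"
          "w \<in> X" "legal_move G (a q) w" "legal_move G w (a' q)"
      | "dispensable G S a b X (a q)" "b' q = b q" "legal_move G (b q) (a' q)" by blast
    then show ?thesis
    proof cases
      case 1
      then show ?thesis using C(2) enc False
        by (intro bexI[of _ w]) (auto simp: dispensable_def)
    next
      case 2
      then show ?thesis using C(3) enc False that ab[OF that] legal_move_sym
        by (intro bexI[of _ "b q"]) (auto simp: dispensable_def)
    qed
  qed
  then obtain w where w: "\<And>q. q \<in> Q \<Longrightarrow> w q \<in> C \<and> legal_move G (a q) (w q) \<and>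
      legal_move G (w q) (a' q) \<and> legal_move G (a' q) (b' q) \<and>
      (\<forall>v\<in>inner_boundary G C. v \<in> {a q, b q} \<longrightarrow>
         v \<in> a ` S \<union> b ` S \<or> (w q = v \<and> b' q = v)) \<and> (q \<in> S \<longrightarrow> w q = b q)"
    by metis
  \<comment> \<open>an old boundary vertex is occupied in any two consecutive phases\<close>
  have bd: "v \<in> (a ` Q \<union> w ` Q) \<inter> (w ` Q \<union> a' ` Q) \<inter> (a' ` Q \<union> b' ` Q)"
    if v: "v \<in> inner_boundary G C" for v
  proof -
    from v C(4) obtain q where q: "q \<in> Q" "v \<in> {a q, b q}" by blast
    with w[OF q(1)] v consider s where "s \<in> S" "v \<in> {a s, b s}" | "w q = v" "b' q = v" by blast
    then show ?thesis
    proof cases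
      case 1
      with \<open>S \<subseteq> Q\<close> have "s \<in> Q" "w s = b s" "a' s = a s" "b' s = b s" using w assms(3) by auto
      with 1 show ?thesis by (metis IntI UnI1 UnI2 empty_iff imageI insert_iff)
    next
      case 2 with q show ?thesis by (metis IntI UnI1 UnI2 imageI)
    qed
  qed
  have wC: "w ` Q \<subseteq> C" using w by blast
  have "reachable_state G Q (C \<union> w ` Q) w"
    by (rule reachable_state.turn[OF C(1)]) (use w bd in auto)
  then have "reachable_state G Q C w" using wC by (simp add: Un_absorb2)
  then have "reachable_state G Q (C \<union> a' ` Q) a'"
    by (rule reachable_state.turn) (use w bd in auto)
  moreover have "inner_boundary G (C \<union> a' ` Q) \<subseteq> a' ` Q \<union> b' ` Q"
    using bd inner_boundary_Un[of G C "a' ` Q"] by blast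
  ultimately have "reachable_state G Q (C \<union> a' ` Q \<union> b' ` Q) b'"
    by (intro reachable_state.turn) (use w in auto)
  moreover have last: "inner_boundary G (C \<union> a' ` Q \<union> b' ` Q) \<subseteq> a' ` Q \<union> b' ` Q"
    using bd inner_boundary_Un[of G C "a' ` Q \<union> b' ` Q"] by (simp only: Un_assoc) blast
  ultimately have "reachable_state G Q (C \<union> a' ` Q \<union> b' ` Q \<union> a' ` Q) a'"
    by (intro reachable_state.turn) (use w legal_move_sym in auto)
  also have "C \<union> a' ` Q \<union> b' ` Q \<union> a' ` Q = C \<union> a' ` Q \<union> b' ` Q" by blast
  finally have "reachable_state G Q (C \<union> a' ` Q \<union> b' ` Q) a'" .
  with last show ?thesis
    unfolding guarded_def using w C(2) by (intro exI conjI) auto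
qed

lemma guarded_mono: "guarded G Q a b X \<Longrightarrow> Y \<subseteq> X \<Longrightarrow> guarded G Q a b Y"
  unfolding guarded_def by blast

lemma winning_of_guarded:
  assumes "pair_wf_digraph G" "finite Q" "guarded G Q a b (pverts G)"
  shows "\<exists>p. winning_strategy 0 G (card Q) p \<and> weakly_monotonic 0 G (card Q) p"
proof -
  from assms(3) obtain C where "reachable_state G Q C a" "pverts G \<subseteq> C"
    unfolding guarded_def by blast
  with reachable_state_subset[OF this(1)] have "reachable_state G Q (pverts G) a" by auto
  from winning_of_reachable_state[OF assms(1,2) this] show ?thesis .
qed

section \<open>The board, and the lower bound\<close>

text \<open>
  Rows and columns are counted from 0, whereas the entries of the vertices are counted from 1.
\<close>

definition cell :: "nat \<Rightarrow> nat \<Rightarrow> nat list" where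
  "cell r c = [Suc r, Suc c]"

lemma cell_eq_iff [simp]: "cell r c = cell r' c' \<longleftrightarrow> r = r' \<and> c = c'"
  by (auto simp: cell_def)

lemma inj_case_prod_cell: "inj_on (case_prod cell) A"
  by (auto simp: inj_on_def)

lemma pverts_hamming_2: "pverts (hamming_graph 2 n) = case_prod cell ` ({..<n} \<times> {..<n})"
proof (intro equalityI subsetI)
  fix v assume "v \<in> pverts (hamming_graph 2 n)"
  then obtain x y where v: "v = [x, y]" "x \<in> {1..n}" "y \<in> {1..n}"
    by (auto simp: hamming_graph_def Let_def length_Suc_conv numeral_2_eq_2)
  then have "v = cell (x - 1) (y - 1)" "x - 1 < n" "y - 1 < n" by (auto simp: cell_def)
  then show "v \<in> case_prod cell ` ({..<n} \<times> {..<n})" by auto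
qed (auto simp: hamming_graph_def Let_def cell_def)

lemma cell_in_hamming_2 [simp]: "cell r c \<in> pverts (hamming_graph 2 n) \<longleftrightarrow> r < n \<and> c < n"
  unfolding pverts_hamming_2 by auto

lemma arc_hamming_2:
  "cell r c \<rightarrow>\<^bsub>hamming_graph 2 n\<^esub> cell r' c' \<longleftrightarrow>
    r < n \<and> c < n \<and> r' < n \<and> c' < n \<and> (r = r' \<longleftrightarrow> c \<noteq> c')"
proof -
  have "{i. i < 2 \<and> cell r c ! i \<noteq> cell r' c' ! i} =
      (if r = r' then {} else {0}) \<union> (if c = c' then {} else {1})"
    by (auto simp: cell_def less_2_cases_iff nth_Cons')
  then have "card {i. i < 2 \<and> cell r c ! i \<noteq> cell r' c' ! i} = 1 \<longleftrightarrow> (r = r' \<longleftrightarrow> c \<noteq> c')"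
    by auto
  then show ?thesis
    by (auto simp: hamming_graph_def Let_def cell_def)
qed

lemma legal_move_hamming_2:
  "legal_move (hamming_graph 2 n) (cell r c) (cell r' c') \<longleftrightarrow>
    r < n \<and> c < n \<and> r' < n \<and> c' < n \<and> (r = r' \<or> c = c')"
  unfolding legal_move_def arc_hamming_2 by auto

definition full_rows :: "nat \<Rightarrow> nat list set \<Rightarrow> nat set" where
  "full_rows n C = {r. r < n \<and> (\<forall>c<n. cell r c \<in> C)}"

definition full_cols :: "nat \<Rightarrow> nat list set \<Rightarrow> nat set" where
  "full_cols n C = {c. c < n \<and> (\<forall>r<n. cell r c \<in> C)}"

lemma full_rows_bound: "full_rows n C \<subseteq> {..<n}" and full_cols_bound: "full_cols n C \<subseteq> {..<n}"
  by (auto simp: full_rows_def full_cols_def)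

lemma card_full_le:
  "card (full_rows n C) \<le> n" "card (full_cols n C) \<le> n"
  using card_mono[OF _ full_rows_bound] card_mono[OF _ full_cols_bound] by fastforce+

lemma interior_hamming_2:
  assumes "C \<subseteq> pverts (hamming_graph 2 n)"
  shows "C - inner_boundary (hamming_graph 2 n) C \<subseteq> case_prod cell ` (full_rows n C \<times> full_cols n C)"
proof
  fix v assume v: "v \<in> C - inner_boundary (hamming_graph 2 n) C"
  with assms obtain r c where rc: "v = cell r c" "r < n" "c < n"
    unfolding pverts_hamming_2 by force
  have "cell r' c' \<in> C" if "r' < n" "c' < n" "r = r' \<or> c = c'" for r' c'
  proof (cases "r = r' \<and> c = c'")
    case False
    with that rc have "cell r' c' \<rightarrow>\<^bsub>hamming_graph 2 n\<^esub> v"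
      unfolding rc(1) arc_hamming_2 by auto
    moreover have "cell r' c' \<in> pverts (hamming_graph 2 n)" using that by simp
    ultimately show ?thesis using v by (auto simp: inner_boundary_def)
  qed (use v rc in auto)
  with rc show "v \<in> case_prod cell ` (full_rows n C \<times> full_cols n C)"
    by (auto simp: full_rows_def full_cols_def)
qed

text \<open>
  Inclusion and exclusion for the union of the full lines, stated without subtraction.
\<close>

lemma card_full_lines:
  assumes "finite C"
  shows "n * card (full_rows n C) + n * card (full_cols n C) \<le>
    card C + card (full_rows n C) * card (full_cols n C)"
proof -
  let ?R = "full_rows n C" and ?K = "full_cols n C"
  have fin: "finite ?R" "finite ?K"
    by (rule finite_subset[OF full_rows_bound] finite_subset[OF full_cols_bound], simp)+
  have "?R \<times> {..<n} \<inter> {..<n} \<times> ?K = ?R \<times> ?K"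
    using full_rows_bound full_cols_bound by blast
  then have "n * card ?R + n * card ?K =
      card (?R \<times> {..<n} \<union> {..<n} \<times> ?K) + card ?R * card ?K"
    using card_Un_Int[of "?R \<times> {..<n}" "{..<n} \<times> ?K"] fin
    by (simp add: card_cartesian_product mult.commute)
  moreover have "case_prod cell ` (?R \<times> {..<n} \<union> {..<n} \<times> ?K) \<subseteq> C"
    by (auto simp: full_rows_def full_cols_def)
  then have "card (?R \<times> {..<n} \<union> {..<n} \<times> ?K) \<le> card C"
    by (metis assms card_image card_mono inj_case_prod_cell)
  ultimately show ?thesis by simp
qed

text \<open>
  For a given sum the product \<open>x y\<close> is at most \<open>(x + y)\<^sup>2 / 4\<close>, and \<open>n s - s\<^sup>2 / 4\<close> increases with \<open>s\<close> up
  to \<open>s = 2 n\<close>, so that the worst case is \<open>x + y = n\<close>, \<open>x' + y' = n - 1\<close>. The bound obtained there is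
  \<open>8 k \<ge> 2 (n\<^sup>2 + n) - 1\<close>, and the summand \<open>- 1\<close> disappears because the other terms are even.
\<close>

lemma crossing_inequality:
  fixes n k x y x' y' c :: nat
  assumes "x' + y' < n" "n \<le> x + y" "x \<le> n" "y \<le> n"
    and "n * x + n * y \<le> c + x * y" "c \<le> 2 * k + x' * y'"
  shows "n^2 + n \<le> 4 * k"
proof -
  define X Y X' Y' N K where ints: "X = int x" "Y = int y" "X' = int x'" "Y' = int y'" "N = int n" "K = int k"
  have le: "N * (X + Y) \<le> 2 * K + X' * Y' + X * Y"
    using assms(5,6) unfolding ints by (simp add: algebra_simps flip: of_nat_mult of_nat_add)
  have b: "X' + Y' \<le> N - 1" "N \<le> X + Y" "X + Y \<le> 2 * N" "0 \<le> X' + Y'"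
    using assms(1-4) unfolding ints by auto
  have "4 * (X' * Y') \<le> (X' + Y')^2" "4 * (X * Y) \<le> (X + Y)^2"
    using sum_squares_ge_zero[of "X' - Y'" 0] sum_squares_ge_zero[of "X - Y" 0]
    by (simp_all add: power2_eq_square algebra_simps)
  moreover have "(X' + Y')^2 \<le> (N - 1)^2" using b by (intro power_mono) auto
  \<comment> \<open>monotonicity of \<open>n s - s\<^sup>2 / 4\<close> between \<open>s = n\<close> and \<open>s = x + y\<close>, multiplied by 4\<close>
  moreover have "(X + Y - N) * (3 * N - (X + Y)) \<ge> 0" using b by (intro mult_nonneg_nonneg) auto
  ultimately have "2 * N^2 + 2 * N - 1 \<le> 8 * K"
    using le by (simp add: power2_eq_square algebra_simps)
  then have "N^2 + N \<le> 4 * K" by presburger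
  then have "int (n^2 + n) \<le> int (4 * k)" unfolding ints by simp
  then show ?thesis by (simp only: of_nat_le_iff)
qed

theorem cop_number_lower_bound:
  assumes "n \<ge> 1" "winning_strategy 0 (hamming_graph 2 n) k p"
  shows "n^2 + n \<le> 4 * k"
proof -
  define G where "G = hamming_graph 2 n"
  interpret pair_graph G unfolding G_def by (rule pair_graph_hamming_graph)
  have wf: "pair_wf_digraph G" by unfold_locales
  from assms(2) obtain N where cs: "cop_strategy G k p" and N: "dirty 0 G k p N = {}"
    unfolding winning_strategy_iff_clean G_def by blast
  define C where "C = clean 0 G k p"
  define x y where "x t = card (full_rows n (C t))" and "y t = card (full_cols n (C t))" for t
  have CV: "C t \<subseteq> pverts G" for t by (auto simp: C_def clean_def)
  have finC: "finite (C t)" for t using CV by (rule finite_subset) simp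
  have lines: "n * x t + n * y t \<le> card (C t) + x t * y t" for t
    unfolding x_def y_def by (rule card_full_lines[OF finC])
  have cops: "card (p t ` {..<k}) \<le> k" for t
    using card_image_le[of "{..<k}" "p t"] by simp
  have "full_rows n (C N) = {..<n}" "full_cols n (C N) = {..<n}"
    using N by (auto simp: full_rows_def full_cols_def C_def clean_def G_def)
  then have "n \<le> x N + y N" by (simp add: x_def y_def)
  \<comment> \<open>the turn at which the number of full lines reaches \<open>n\<close>\<close>
  then obtain T where T: "n \<le> x T + y T" "\<And>t. t < T \<Longrightarrow> x t + y t < n"
    using LeastI[of "\<lambda>t. n \<le> x t + y t" N] not_less_Least[of _ "\<lambda>t. n \<le> x t + y t"]
    by (meson not_le)
  have xy: "x T \<le> n" "y T \<le> n" by (simp_all add: x_def y_def card_full_le)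
  show ?thesis
  proof (cases T)
    case 0
    \<comment> \<open>the initial placement: nothing was clean before, so the estimate holds with \<open>x' = y' = 0\<close>\<close>
    have "C T = p 0 ` {..<k}" unfolding C_def 0 by (rule clean_0[OF wf cs])
    then have "card (C T) \<le> 2 * k + 0 * 0" using cops[of 0] by simp
    then show ?thesis using crossing_inequality[of 0 0 n "x T" "y T"] T(1) xy lines[of T] assms(1) by auto
  next
    case (Suc t)
    let ?I = "case_prod cell ` (full_rows n (C t) \<times> full_cols n (C t))"
    have "C T = (C t - inner_boundary G (C t)) \<union> p t ` {..<k} \<union> p T ` {..<k}"
      unfolding Suc C_def by (rule clean_Suc[OF wf cs])
    moreover have "C t - inner_boundary G (C t) \<subseteq> ?I"
      using interior_hamming_2[of "C t" n] CV[of t] unfolding G_def by blast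
    ultimately have "C T \<subseteq> (?I \<union> p t ` {..<k}) \<union> p T ` {..<k}" by blast
    moreover have "finite ?I"
      by (intro finite_imageI finite_cartesian_product
          finite_subset[OF full_rows_bound] finite_subset[OF full_cols_bound]) simp_all
    ultimately have "card (C T) \<le> card ((?I \<union> p t ` {..<k}) \<union> p T ` {..<k})"
      by (intro card_mono) auto
    also have "\<dots> \<le> card ?I + card (p t ` {..<k}) + card (p T ` {..<k})"
      by (intro order_trans[OF card_Un_le] add_mono card_Un_le) simp
    also have "\<dots> \<le> x t * y t + k + k"
      using cops[of t] cops[of T]
      by (intro add_mono) (auto simp: x_def y_def card_image inj_case_prod_cell card_cartesian_product)
    finally show ?thesis
      using crossing_inequality[of "x t" "y t" n "x T" "y T"] T(1) T(2)[of t] xy lines[of T] Suc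
      by auto
  qed
qed

section \<open>The conveyor of column cops\<close>

text \<open>
  \<open>Col p j\<close> is a cop of the conveyor, working in rows \<open>2 p\<close> and \<open>2 p + 1\<close> of the upper or lower part;
  \<open>Row r i\<close> belongs to row \<open>r\<close> of the strip.
\<close>

datatype cop = Col nat nat | Row nat nat

locale board =
  fixes h s n :: nat
  assumes n_eq: "n = 4 * h + s"
begin

abbreviation "H \<equiv> hamming_graph 2 n"

sublocale pair_graph H
  by (rule pair_graph_hamming_graph)

definition team :: "cop set" where
  "team = case_prod Col ` ({..<h} \<times> {..n}) \<union> case_prod Row ` ({..<s} \<times> {..h})"

definition strip :: "nat \<Rightarrow> nat \<Rightarrow> nat list" where
  "strip r c = cell (2 * h + r) c"

text \<open>
  At stage \<open>y\<close> of the conveyor the lower part of the columns before \<open>y\<close> has been cleaned. Cop \<open>Col p j\<close>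
  starts in the upper part of column \<open>j - 1\<close> and moves, in the step from stage \<open>j\<close> to \<open>j + 1\<close>, to
  the lower part of column \<open>j\<close>. The cops \<open>Col p y\<close> are the spare ones at stage \<open>y\<close>. Since \<open>0 - 1 = 0\<close>,
  \<open>Col p 0\<close> at first duplicates \<open>Col p 1\<close>, so that she is spare, too.
\<close>

definition col_beat :: "nat \<Rightarrow> nat \<Rightarrow> nat \<Rightarrow> nat list \<times> nat list" where
  "col_beat y p j =
     (if j < y then (cell (2 * h + s + 2 * p) j, cell (2 * h + s + 2 * p + 1) j)
      else (cell (2 * p) (j - 1), cell (2 * p + 1) (j - 1)))"

definition strip_pair :: "nat \<Rightarrow> nat \<Rightarrow> nat list \<times> nat list" where
  "strip_pair r c = (strip r c, strip r (c + 1))"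

definition beats ::
  "(nat \<Rightarrow> nat \<Rightarrow> nat list \<times> nat list) \<Rightarrow> (nat \<Rightarrow> nat \<Rightarrow> nat list \<times> nat list) \<Rightarrow> cop \<Rightarrow> nat list \<times> nat list"
  where "beats K R q = (case q of Col p j \<Rightarrow> K p j | Row r i \<Rightarrow> R r i)"

text \<open>
  What is clean at stage \<open>y\<close>. The conveyor determines the upper and the lower part; the cells of the
  strip are listed in \<open>W\<close>, with rows counted from the top of the strip.
\<close>

definition region :: "nat \<Rightarrow> (nat \<times> nat) set \<Rightarrow> nat list set" where
  "region y W = case_prod cell ` {(r, c). r < n \<and> c < n \<and>
     (r < 2 * h \<or> 2 * h + s \<le> r \<and> c < y \<or> 2 * h \<le> r \<and> r < 2 * h + s \<and> (r - 2 * h, c) \<in> W)}"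

definition held :: "(cop \<Rightarrow> nat list \<times> nat list) \<Rightarrow> nat list set \<Rightarrow> bool" where
  "held P X \<longleftrightarrow> guarded H team (fst \<circ> P) (snd \<circ> P) X"

text \<open>
  Inequalities are more useful than the equation, which the automation would use to eliminate \<open>n\<close>.
\<close>

lemma n_ge: "4 * h + s \<le> n" and n_le: "n \<le> 4 * h + s"
  by (simp_all add: n_eq)

abbreviation cells :: "(cop \<Rightarrow> nat list \<times> nat list) \<Rightarrow> nat list set" where
  "cells P \<equiv> (\<Union>q\<in>team. {fst (P q), snd (P q)})"

lemma beats_simps [simp]: "beats K R (Col p j) = K p j" "beats K R (Row r i) = R r i"
  by (simp_all add: beats_def)

lemma finite_team: "finite team"
  by (simp add: team_def)

lemma card_team: "card team = h * (n + 1) + s * (h + 1)"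
proof -
  have "inj_on (case_prod Col) A" "inj_on (case_prod Row) A" for A
    by (auto simp: inj_on_def)
  then show ?thesis
    unfolding team_def by (subst card_Un_disjoint) (auto simp: card_image card_cartesian_product)
qed

lemma team_cases:
  assumes "q \<in> team"
  obtains p j where "q = Col p j" "p < h" "j \<le> n" | r i where "q = Row r i" "r < s" "i \<le> h"
  using assms unfolding team_def by auto

lemma Col_in_team [simp]: "Col p j \<in> team \<longleftrightarrow> p < h \<and> j \<le> n"
  and Row_in_team [simp]: "Row r i \<in> team \<longleftrightarrow> r < s \<and> i \<le> h"
  by (auto simp: team_def)

lemma cell_in_region [simp]:
  "cell r c \<in> region y W \<longleftrightarrow> r < n \<and> c < n \<and>
     (r < 2 * h \<or> 2 * h + s \<le> r \<and> c < y \<or> 2 * h \<le> r \<and> r < 2 * h + s \<and> (r - 2 * h, c) \<in> W)"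
  unfolding region_def by auto

lemma strip_in_region [simp]: "strip r c \<in> region y W \<longleftrightarrow> c < n \<and> (r < s \<and> (r, c) \<in> W \<or> s \<le> r \<and> 2 * h + r < n \<and> c < y)"
  unfolding strip_def using n_ge by auto

lemma region_full: "{..<s} \<times> {..<n} \<subseteq> W \<Longrightarrow> region n W = pverts H"
  unfolding region_def pverts_hamming_2 by (rule arg_cong[of _ _ "image _"]) (use n_ge in auto)

lemma enclosed_cellI:
  assumes "\<And>c'. c' < n \<Longrightarrow> cell r c' \<in> X" "\<And>r'. r' < n \<Longrightarrow> cell r' c \<in> X"
  shows "enclosed H X (cell r c)"
  unfolding enclosed_def
proof (intro allI impI)
  fix u assume arc: "cell r c \<rightarrow>\<^bsub>H\<^esub> u"
  then have "u \<in> pverts H" using arcs_ends_conv by (auto dest: adj_in_verts)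
  then obtain r' c' where "u = cell r' c'" "r' < n" "c' < n"
    unfolding pverts_hamming_2 by force
  with arc assms show "u \<in> X" unfolding \<open>u = _\<close> arc_hamming_2 by metis
qed

lemma enclosed_in_strip:
  assumes "\<And>c'. c' < n \<Longrightarrow> (r, c') \<in> W" "\<And>r'. r' < s \<Longrightarrow> (r', c) \<in> W" "r < s" "c < y" "c < n"
  shows "enclosed H (region y W) (strip r c)"
  unfolding strip_def by (rule enclosed_cellI) (use assms n_ge in auto)

lemma dispensable_if_covered:
  assumes "q \<in> S" "v = fst (P q) \<or> v = snd (P q)"
  shows "dispensable H S (fst \<circ> P) (snd \<circ> P) X v"
  using assms unfolding dispensable_def by (auto simp: image_iff)

text \<open>
  The two ways of changing a pair that \<open>guarded_move\<close> allows: walking and sliding. The cops in \<open>S\<close> are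
  those that keep their pairs.
\<close>

definition can_switch ::
  "cop set \<Rightarrow> (cop \<Rightarrow> nat list \<times> nat list) \<Rightarrow> nat list set \<Rightarrow> cop \<Rightarrow> nat list \<times> nat list \<Rightarrow> bool"
  where "can_switch S P X q d \<longleftrightarrow>
    dispensable H S (fst \<circ> P) (snd \<circ> P) X (fst (P q)) \<and>
    (dispensable H S (fst \<circ> P) (snd \<circ> P) X (snd (P q)) \<and> legal_move H (fst d) (snd d) \<and>
       (\<exists>w\<in>X. legal_move H (fst (P q)) w \<and> legal_move H w (fst d)) \<or>
     snd d = snd (P q) \<and> legal_move H (snd (P q)) (fst d))"

lemma held_move:
  assumes "held P X" "S \<subseteq> team" "\<And>q. q \<in> S \<Longrightarrow> P' q = P q"
    and "\<And>q. q \<in> team - S \<Longrightarrow> can_switch S P X q (P' q)"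
    and "X' \<subseteq> X \<union> cells P'"
  shows "held P' X'"
  unfolding held_def
proof (rule guarded_mono)
  show "guarded H team (fst \<circ> P') (snd \<circ> P') (X \<union> (fst \<circ> P') ` team \<union> (snd \<circ> P') ` team)"
    by (rule guarded_move[OF assms(1)[unfolded held_def] assms(2)]) (use assms(3,4) in \<open>auto simp: can_switch_def\<close>)
qed (use assms(5) in auto)

lemma held_start:
  assumes "\<And>r i. r < s \<Longrightarrow> i \<le> h \<Longrightarrow> legal_move H (fst (R r i)) (snd (R r i))"
    and "\<And>r c. (r, c) \<in> W \<Longrightarrow> r < s \<Longrightarrow> c < n \<Longrightarrow> \<exists>r' i. r' < s \<and> i \<le> h \<and> strip r c \<in> {fst (R r' i), snd (R r' i)}"
  shows "held (beats (col_beat 0) R) (region 0 W)"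
  unfolding held_def
proof (rule guarded_mono)
  let ?P = "beats (col_beat 0) R"
  show "guarded H team (fst \<circ> ?P) (snd \<circ> ?P) ((fst \<circ> ?P) ` team \<union> (snd \<circ> ?P) ` team)"
  proof (rule guarded_start)
    fix q assume "q \<in> team"
    then show "legal_move H ((fst \<circ> ?P) q) ((snd \<circ> ?P) q)"
      by (cases rule: team_cases) (use assms(1) n_ge in \<open>auto simp: col_beat_def legal_move_hamming_2\<close>)
  qed
  show "region 0 W \<subseteq> (fst \<circ> ?P) ` team \<union> (snd \<circ> ?P) ` team"
  proof
    fix v assume v: "v \<in> region 0 W"
    then obtain r c where rc: "v = cell r c" unfolding region_def by auto
    with v have lt: "r < n" "c < n" by auto
    show "v \<in> (fst \<circ> ?P) ` team \<union> (snd \<circ> ?P) ` team"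
    proof (cases "r < 2 * h")
      case True
      let ?q = "Col (r div 2) (Suc c)"
      have "?q \<in> team" using True lt by auto
      moreover have "v = fst (?P ?q) \<or> v = snd (?P ?q)"
        unfolding rc by (simp add: col_beat_def) presburger
      ultimately show ?thesis by (metis UnI1 UnI2 comp_apply imageI)
    next
      case False
      with v rc have "(r - 2 * h, c) \<in> W" "r - 2 * h < s" "v = strip (r - 2 * h) c"
        by (auto simp: strip_def)
      with assms(2)[of "r - 2 * h" c] lt obtain r' i where
        i: "Row r' i \<in> team" and "v \<in> {fst (R r' i), snd (R r' i)}" by auto
      then have "v = fst (?P (Row r' i)) \<or> v = snd (?P (Row r' i))" by simp
      then show ?thesis using i by (metis UnI1 UnI2 comp_apply imageI)
    qed
  qed
qed

text \<open>
  The spare cops \<open>Col p y\<close> leave the upper part of column \<open>y - 1\<close>, where all cells are interior because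
  this column and the upper rows are clean. They walk along their row to column \<open>y\<close> and then
  down the column.
\<close>

lemma conveyor_step:
  assumes "held (beats (col_beat y) R) (region y W)" "y < n"
    and strip: "\<And>r c. r < s \<Longrightarrow> c < y \<Longrightarrow> (r, c) \<in> W"
  shows "held (beats (col_beat (Suc y)) R) (region (Suc y) W)"
proof (rule held_move[OF assms(1)])
  let ?P = "beats (col_beat y) R" and ?P' = "beats (col_beat (Suc y)) R"
  define S where "S = team - (\<lambda>p. Col p y) ` {..<h}"
  show "S \<subseteq> team" by (auto simp: S_def)
  show "?P' q = ?P q" if "q \<in> S" for q
  proof -
    from that have "q \<in> team" by (simp add: S_def)
    then show ?thesis
      by (cases rule: team_cases) (use that in \<open>auto simp: S_def col_beat_def\<close>)
  qed
  fix q assume "q \<in> team - S"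
  then obtain p where q: "q = Col p y" "p < h" by (auto simp: S_def)
  \<comment> \<open>at stage 0 column \<open>y - 1\<close> is column 0, held by \<open>Col p 1\<close> as well\<close>
  have disp: "dispensable H S (fst \<circ> ?P) (snd \<circ> ?P) (region y W) (cell (2 * p + i) (y - 1))" if "i \<in> {0, 1}" for i
  proof (cases y)
    case 0
    have "Col p 1 \<in> S" using q 0 \<open>y < n\<close> by (auto simp: S_def)
    then show ?thesis
      by (rule dispensable_if_covered) (use that 0 in \<open>auto simp: col_beat_def\<close>)
  next
    case (Suc z)
    show ?thesis unfolding dispensable_def
      by (intro disjI1 enclosed_cellI) (use q Suc that \<open>y < n\<close> n_ge strip in auto)
  qed
  show "can_switch S ?P (region y W) q (?P' q)"
    using disp[of 0] disp[of 1] q \<open>y < n\<close> n_ge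
    by (auto simp: can_switch_def col_beat_def legal_move_hamming_2 intro!: bexI[of _ "cell (2 * p) y"])
next
  let ?P' = "beats (col_beat (Suc y)) R"
  show "region (Suc y) W \<subseteq> region y W \<union> cells ?P'"
  proof
    fix v assume v: "v \<in> region (Suc y) W"
    then obtain r c where rc: "v = cell r c" unfolding region_def by auto
    show "v \<in> region y W \<union> cells ?P'"
    proof (cases "v \<in> region y W")
      case False
      with v rc have new: "2 * h + s \<le> r" "c = y" "r < n" by (auto simp: less_Suc_eq)
      let ?p = "(r - (2 * h + s)) div 2"
      have "Col ?p y \<in> team" using new assms(2) n_le by auto
      moreover have "v \<in> {fst (col_beat (Suc y) ?p y), snd (col_beat (Suc y) ?p y)}"
        unfolding rc using new by (simp add: col_beat_def) presburger
      ultimately show ?thesis by (intro UnI2 UN_I[of "Col ?p y"]) auto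
    qed simp
  qed
qed

lemma conveyor:
  assumes "held (beats (col_beat y) R) (region y W)" "y \<le> z" "z \<le> n"
    and "\<And>r c. r < s \<Longrightarrow> c + 1 < z \<Longrightarrow> (r, c) \<in> W"
  shows "held (beats (col_beat z) R) (region z W)"
  using assms(2,1,3,4)
proof (induction rule: dec_induct)
  case (step i)
  then show ?case using conveyor_step[of i R W] by auto
qed

section \<open>Cleaning a whole row of the strip\<close>

lemma region_cases:
  assumes "v \<in> region y W'"
  obtains "v \<in> region y W" | r c where "r < s" "c < n" "v = strip r c" "(r, c) \<in> W'"
proof -
  from assms obtain r c where rc: "v = cell r c" unfolding region_def by auto
  show thesis
  proof (cases "2 * h \<le> r \<and> r < 2 * h + s")
    case True
    with assms rc show thesis by (intro that(2)[of "r - 2 * h" c]) (auto simp: strip_def)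
  next
    case False
    with assms rc show thesis by (intro that(1)) auto
  qed
qed

lemma legal_move_strip [simp]:
  "r < s \<Longrightarrow> r' < s \<Longrightarrow>
    legal_move H (strip r c) (strip r' c') \<longleftrightarrow> c < n \<and> c' < n \<and> (r = r' \<or> c = c')"
  unfolding strip_def legal_move_hamming_2 using n_ge by auto

text \<open>
  A strip cop whose two cells have become interior is free for another task in the strip.
\<close>

lemma reassign_row_cop:
  assumes "held (beats (col_beat y) R) (region y W)" "u < s" "i \<le> h"
    and "enclosed H (region y W) (fst (R u i))" "enclosed H (region y W) (snd (R u i))"
    and "legal_move H (fst d) (snd d)"
    and "w \<in> region y W" "legal_move H (fst (R u i)) w" "legal_move H w (fst d)"
    and W': "\<And>r c. (r, c) \<in> W' \<Longrightarrow> r < s \<Longrightarrow> c < n \<Longrightarrow> (r, c) \<in> W \<or> strip r c \<in> {fst d, snd d}"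
  shows "held (beats (col_beat y) (R(u := (R u)(i := d)))) (region y W')"
proof (rule held_move[OF assms(1), of "team - {Row u i}"])
  let ?P = "beats (col_beat y) R" and ?P' = "beats (col_beat y) (R(u := (R u)(i := d)))"
  fix q assume "q \<in> team - (team - {Row u i})"
  then have q: "q = Row u i" by simp
  show "can_switch (team - {Row u i}) ?P (region y W) q (?P' q)"
    using assms(4-9) by (auto simp: q can_switch_def dispensable_def)
next
  let ?P' = "beats (col_beat y) (R(u := (R u)(i := d)))"
  show "region y W' \<subseteq> region y W \<union> cells ?P'"
  proof
    fix v assume "v \<in> region y W'"
    then show "v \<in> region y W \<union> cells ?P'"
    proof (cases rule: region_cases[of v y W' W])
      case (2 r c)
      with W'[of r c] consider "(r, c) \<in> W" | "v \<in> {fst d, snd d}" by blast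
      then show ?thesis
      proof cases
        case 1 with 2 show ?thesis by simp
      next
        case 2 with assms(2,3) show ?thesis by (intro UnI2 UN_I[of "Row u i"]) auto
      qed
    qed simp
  qed
qed (auto simp: beats_def split: cop.split)

text \<open>
  Row \<open>r\<close> of the strip is completed and afterwards held by its own cops. The spare cops
  of the conveyor clean the \<open>2 h\<close> cells from column \<open>c0\<close> on; at the same time strip cops may slide, which
  can contribute further cells. Now row \<open>r\<close> is clean, and the pairs that its first \<open>h\<close> cops held in the
  columns before \<open>y\<close> are interior. These cops walk to the pairs of the spare cops, whom
  they relieve: the spare cops return to the upper part of column \<open>y - 1\<close>.
\<close>

lemma fill_row:
  assumes held: "held (beats (col_beat y) R) (region y W)"
    and y: "y \<le> n" "2 * h \<le> y" and r: "r < s" and c0: "c0 + 2 * h \<le> n"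
    and W: "\<And>r' c. r' < s \<Longrightarrow> c < y \<Longrightarrow> (r', c) \<in> W"
    and row: "\<And>c. c < n \<Longrightarrow> (r, c) \<in> W \<or> c0 \<le> c \<and> c < c0 + 2 * h \<or>
        (\<exists>u<s. \<exists>i\<le>h. fst (R' u i) = strip r c)"
    and left: "\<And>i. i < h \<Longrightarrow> R r i = strip_pair r (2 * i) \<and> R' r i = R r i"
    and slide: "\<And>u i. u < s \<Longrightarrow> i \<le> h \<Longrightarrow> R' u i = R u i \<or>
        enclosed H (region y W) (fst (R u i)) \<and> snd (R' u i) = snd (R u i) \<and>
        legal_move H (snd (R u i)) (fst (R' u i))"
  shows "held (beats (col_beat y) (\<lambda>u i. if u = r \<and> i < h then strip_pair r (c0 + 2 * i) else R' u i))
    (region y (W \<union> {r} \<times> {..<n}))"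
proof -
  define K where "K = (\<lambda>p j. if j = y then strip_pair r (c0 + 2 * p) else col_beat y p j)"
  define R'' where "R'' = (\<lambda>u i. if u = r \<and> i < h then strip_pair r (c0 + 2 * i) else R' u i)"
  define W' where "W' = W \<union> {r} \<times> {..<n}"
  define P0 P1 P2 P3 where P: "P0 = beats (col_beat y) R" "P1 = beats K R'"
    "P2 = beats K R''" "P3 = beats (col_beat y) R''"
  have upper: "col_beat y p y = (cell (2 * p) (y - 1), cell (2 * p + 1) (y - 1))" for p
    by (simp add: col_beat_def)
  \<comment> \<open>the spare cops walk through the upper rows, which are clean throughout\<close>
  have detour: "cell (2 * p) (c0 + 2 * p) \<in> region y V" if "p < h" for p V
    using that c0 n_ge by simp
  have detour_legal: "legal_move H (cell (2 * p) (y - 1)) (cell (2 * p) (c0 + 2 * p))"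
    "legal_move H (cell (2 * p) (c0 + 2 * p)) (strip r (c0 + 2 * p))" if "p < h" for p
    using that c0 y r n_ge by (auto simp: strip_def legal_move_hamming_2)
  \<comment> \<open>the spare cops complete the row\<close>
  have "held P1 (region y W')"
  proof (rule held_move[of P0 _ "{q \<in> team. P1 q = P0 q}"])
    show "held P0 (region y W)" unfolding P by (rule held)
    fix q assume q: "q \<in> team - {q \<in> team. P1 q = P0 q}"
    then have "q \<in> team" by simp
    then show "can_switch {q \<in> team. P1 q = P0 q} P0 (region y W) q (P1 q)"
    proof (cases rule: team_cases)
      case (1 p j)
      with q have j: "j = y" by (auto simp: P K_def split: if_splits)
      have y0: "0 < y" using y(2) 1 by simp
      have "enclosed H (region y W) (cell (2 * p + e) (y - 1))" if "e \<le> 1" for e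
        by (rule enclosed_cellI) (use 1 that y y0 n_ge W in auto)
      from this[of 0] this[of 1] show ?thesis
        using detour[OF 1(2)] detour_legal[OF 1(2)] c0 r 1
        by (auto simp: P j K_def upper strip_pair_def can_switch_def dispensable_def)
    next
      case (2 u i)
      with q slide[of u i] show ?thesis by (auto simp: P can_switch_def dispensable_def)
    qed
  next
    show "region y W' \<subseteq> region y W \<union> cells P1"
    proof
      fix v assume "v \<in> region y W'"
      then show "v \<in> region y W \<union> cells P1"
      proof (cases rule: region_cases[of v y W' W])
        case (2 r' c)
        then consider "(r', c) \<in> W" | "r' = r" "c0 \<le> c" "c < c0 + 2 * h"
          | u i where "r' = r" "u < s" "i \<le> h" "fst (R' u i) = strip r c"
          using row[of c] unfolding W'_def by blast
        then show ?thesis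
        proof cases
          case 1 with 2 show ?thesis by simp
        next
          case c: 2
          let ?p = "(c - c0) div 2"
          have "c = c0 + 2 * ?p \<or> c = c0 + 2 * ?p + 1" using c(2) by presburger
          moreover have "?p < h" by (intro less_mult_imp_div_less) (use c(2,3) in auto)
          ultimately show ?thesis
            using 2 c y by (intro UnI2 UN_I[of "Col ?p y"]) (auto simp: P K_def strip_pair_def)
        next
          case 3
          with 2 show ?thesis by (intro UnI2 UN_I[of "Row u i"]) (auto simp: P)
        qed
      qed simp
    qed
  qed auto
  \<comment> \<open>the cops of row \<open>r\<close> double the spare cops\<close>
  then have "held P2 (region y W')"
  proof (rule held_move[of P1 _ "{q \<in> team. P2 q = P1 q}"])
    fix q assume q: "q \<in> team - {q \<in> team. P2 q = P1 q}"
    then have "q \<in> team" by simp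
    then show "can_switch {q \<in> team. P2 q = P1 q} P1 (region y W') q (P2 q)"
    proof (cases rule: team_cases)
      case (1 p j)
      with q show ?thesis by (simp add: P)
    next
      case (2 u i)
      with q have ui: "u = r" "i < h" by (auto simp: P R''_def split: if_splits)
      have "enclosed H (region y W') (strip r (2 * i + e))" if "e \<le> 1" for e
        by (rule enclosed_in_strip) (use ui that y r W in \<open>auto simp: W'_def\<close>)
      from this[of 0] this[of 1] have "enclosed H (region y W') (strip r (2 * i))"
        "enclosed H (region y W') (strip r (Suc (2 * i)))" by auto
      then show ?thesis
        using ui left[OF ui(2)] c0 r y
        by (auto simp: 2 P R''_def strip_pair_def can_switch_def dispensable_def W'_def
            intro!: bexI[of _ "strip r (c0 + 2 * i)"])
    qed
  qed auto
  \<comment> \<open>the spare cops are relieved\<close>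
  then have "held P3 (region y W')"
  proof (rule held_move[of P2 _ "{q \<in> team. P3 q = P2 q}"])
    fix q assume q: "q \<in> team - {q \<in> team. P3 q = P2 q}"
    then have "q \<in> team" by simp
    then show "can_switch {q \<in> team. P3 q = P2 q} P2 (region y W') q (P3 q)"
    proof (cases rule: team_cases)
      case (1 p j)
      with q have j: "j = y" by (auto simp: P K_def split: if_splits)
      have in_S: "Row r p \<in> {q \<in> team. P3 q = P2 q}" using r 1 by (simp add: P)
      have eq: "P2 q = P2 (Row r p)" using 1 by (simp add: P j K_def R''_def)
      have disp: "dispensable H {q \<in> team. P3 q = P2 q} (fst \<circ> P2) (snd \<circ> P2) (region y W') v"
        if "v = fst (P2 q) \<or> v = snd (P2 q)" for v
        by (rule dispensable_if_covered[OF in_S]) (use that eq in auto)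
      have pos: "P2 q = strip_pair r (c0 + 2 * p)" "P3 q = (cell (2 * p) (y - 1), cell (2 * p + 1) (y - 1))"
        using 1 by (simp_all add: P j K_def upper)
      have "legal_move H (fst (P3 q)) (snd (P3 q))"
        using 1(2) y n_ge unfolding pos by (auto simp: legal_move_hamming_2)
      moreover have "legal_move H (fst (P2 q)) (cell (2 * p) (c0 + 2 * p))"
        "legal_move H (cell (2 * p) (c0 + 2 * p)) (fst (P3 q))"
        using detour_legal[OF 1(2), THEN legal_move_sym] by (simp_all add: pos strip_pair_def)
      ultimately show ?thesis using disp detour[OF 1(2)] unfolding can_switch_def by blast
    next
      case (2 u i)
      with q show ?thesis by (simp add: P)
    qed
  qed auto
  then show ?thesis unfolding P R''_def W'_def .
qed

section \<open>The winning strategy and the value\<close>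

text \<open>
  In each strip row \<open>h\<close> of the cops hold the first \<open>2 h\<close> cells, and the last one holds the cells from
  column \<open>4 h\<close> on, of which there are \<open>s \<le> 2\<close>. When the conveyor has cleaned \<open>2 h\<close> columns, the \<open>2 h\<close>
  cells in the middle are just what the spare cops can clean, for one row after the other.
\<close>

lemma board_cleared_if_strip_le_2:
  assumes "s \<le> 2"
  shows "\<exists>P. held P (pverts H)"
proof -
  \<comment> \<open>the minimum truncates the last pair to a single cell if \<open>s = 1\<close>\<close>
  define R where "R = (\<lambda>r i. if i < h then strip_pair r (2 * i)
    else (strip r (4 * h), strip r (min (4 * h + 1) (n - 1))))"
  define W where "W = {(r :: nat, c). c < 2 * h \<or> 4 * h \<le> c}"
  \<comment> \<open>the pairs of the strip cops when \<open>m\<close> rows are complete\<close>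
  define RR where "RR m = (\<lambda>r i. if r < m \<and> i < h then strip_pair r (2 * h + 2 * i) else R r i)" for m
  have s_n: "4 * h < n" if "r < s" for r using that n_ge by simp
  have "held (beats (col_beat 0) R) (region 0 W)"
  proof (rule held_start)
    show "legal_move H (fst (R r i)) (snd (R r i))" if "r < s" "i \<le> h" for r i
      using that s_n[OF that(1)] by (auto simp: R_def strip_pair_def)
    fix r c assume rc: "(r, c) \<in> W" "r < s" "c < n"
    show "\<exists>r' i. r' < s \<and> i \<le> h \<and> strip r c \<in> {fst (R r' i), snd (R r' i)}"
    proof (cases "c < 2 * h")
      case True
      then have "c div 2 < h" "c = 2 * (c div 2) \<or> c = 2 * (c div 2) + 1" by auto
      then show ?thesis using rc(2)
        by (intro exI[of _ r] exI[of _ "c div 2"]) (auto simp: R_def strip_pair_def)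
    next
      case False
      with rc n_le assms have "c = 4 * h \<or> c = min (4 * h + 1) (n - 1)" by (auto simp: W_def)
      then show ?thesis using rc(2)
        by (intro exI[of _ r] exI[of _ h]) (auto simp: R_def)
    qed
  qed
  then have "held (beats (col_beat (2 * h)) R) (region (2 * h) W)"
    by (rule conveyor) (use n_ge in \<open>auto simp: W_def\<close>)
  then have "m \<le> s \<Longrightarrow> held (beats (col_beat (2 * h)) (RR m)) (region (2 * h) (W \<union> {..<m} \<times> {..<n}))" for m
  proof (induction m)
    case 0
    then show ?case by (simp add: RR_def)
  next
    case (Suc m)
    have "held (beats (col_beat (2 * h)) (\<lambda>u i. if u = m \<and> i < h then strip_pair m (2 * h + 2 * i) else RR m u i))
        (region (2 * h) ((W \<union> {..<m} \<times> {..<n}) \<union> {m} \<times> {..<n}))"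
      using Suc.prems n_ge by (intro fill_row[OF Suc.IH]) (auto simp: W_def RR_def R_def)
    also have "(\<lambda>u i. if u = m \<and> i < h then strip_pair m (2 * h + 2 * i) else RR m u i) = RR (Suc m)"
      by (auto simp: RR_def fun_eq_iff)
    also have "(W \<union> {..<m} \<times> {..<n}) \<union> {m} \<times> {..<n} = W \<union> {..<Suc m} \<times> {..<n}"
      by (auto simp: less_Suc_eq)
    finally show ?case .
  qed
  then have "held (beats (col_beat (2 * h)) (RR s)) (region (2 * h) (W \<union> {..<s} \<times> {..<n}))" by simp
  then have "held (beats (col_beat n) (RR s)) (region n (W \<union> {..<s} \<times> {..<n}))"
    by (rule conveyor) (use n_ge in auto)
  then show ?thesis using region_full[of "W \<union> {..<s} \<times> {..<n}"] by auto
qed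

text \<open>
  With \<open>m = 2 h + 1\<close> and \<open>n = 2 m + 1\<close>, the cells that must be held number exactly \<open>2 k\<close> both while
  column \<open>m\<close> is cleaned and while row 1 of the strip is completed after that, so no cop may hold fewer
  than two of them. As \<open>m\<close> is odd, horizontal pairs do not suffice: in the columns \<open>2 h\<close> and \<open>m\<close>
  the cells of rows 1 and 2 of the strip are held by vertical pairs. When row 1 is to be completed, an odd
  number of its cells is missing; the one in column \<open>m + 1\<close> is held together with its neighbour in
  row 0, by the cop who has held that neighbour together with the cell of column \<open>m\<close>, now interior. In
  the same way the vertical pair of column \<open>m\<close> becomes a horizontal pair of row 2. This leaves \<open>2 h\<close>
  cells for the spare cops each time.
\<close>

lemma board_cleared_if_strip_eq_3:
  assumes "s = 3"
  shows "\<exists>P. held P (pverts H)"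
proof -
  define m where "m = 2 * h + 1"
  have n: "2 * m + 1 \<le> n" and n_upper: "n \<le> 2 * m + 1" using n_eq assms by (simp_all add: m_def)
  have s: "0 < s" "1 < s" "2 < s" using assms by auto
  \<comment> \<open>rows 0, 1, 2: left pairs; then \<open>Row 0 h\<close> at the right end of row 0, \<open>Row 1 h\<close> on a single cell, \<open>Row 2 h\<close> on the vertical pair in column \<open>2 h\<close>\<close>
  define R0 where "R0 = (\<lambda>r i. if i < h then strip_pair r (2 * i)
    else if r = 0 then strip_pair 0 (2 * m - 1)
    else if r = 1 then (strip 0 (2 * h), strip 0 (2 * h))
    else (strip 1 (2 * h), strip 2 (2 * h)))"
  define W0 where "W0 = {(r :: nat, c). c < m \<or> r = 0 \<and> 2 * m - 1 \<le> c}"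
  have "held (beats (col_beat 0) R0) (region 0 W0)"
  proof (rule held_start)
    show "legal_move H (fst (R0 r i)) (snd (R0 r i))" if "r < s" "i \<le> h" for r i
      using that s n by (auto simp: R0_def strip_pair_def m_def)
    fix r c assume rc: "(r, c) \<in> W0" "r < s" "c < n"
    consider "c < 2 * h" | "c = 2 * h" "r = 0" | "c = 2 * h" "0 < r" | "r = 0" "2 * m - 1 \<le> c"
      using rc by (auto simp: W0_def m_def less_Suc_eq)
    then show "\<exists>r' i. r' < s \<and> i \<le> h \<and> strip r c \<in> {fst (R0 r' i), snd (R0 r' i)}"
    proof cases
      case 1
      then have "c div 2 < h" "c = 2 * (c div 2) \<or> c = 2 * (c div 2) + 1" by auto
      then show ?thesis using rc(2)
        by (intro exI[of _ r] exI[of _ "c div 2"]) (auto simp: R0_def strip_pair_def)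
    next
      case 2
      then show ?thesis using s by (intro exI[of _ 1] exI[of _ h]) (auto simp: R0_def)
    next
      case 3
      then have "r = 1 \<or> r = 2" using rc(2) assms by auto
      with 3 show ?thesis using s by (intro exI[of _ 2] exI[of _ h]) (auto simp: R0_def)
    next
      case 4
      then have "c = 2 * m - 1 \<or> c = 2 * m - 1 + 1" using rc(3) n_upper by auto
      with 4 show ?thesis using s
        by (intro exI[of _ 0] exI[of _ h]) (auto simp: R0_def strip_pair_def)
    qed
  qed
  then have 1: "held (beats (col_beat m) R0) (region m W0)"
    by (rule conveyor) (use n in \<open>auto simp: W0_def\<close>)
  \<comment> \<open>row 0 is completed\<close>
  define R1 where "R1 = (\<lambda>u i. if u = 0 \<and> i < h then strip_pair 0 (m + 2 * i) else R0 u i)"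
  define W1 where "W1 = W0 \<union> {0} \<times> {..<n}"
  have 2: "held (beats (col_beat m) R1) (region m W1)"
    unfolding R1_def W1_def
    by (rule fill_row[OF 1]) (use n s in \<open>auto simp: W0_def R0_def m_def\<close>)
  \<comment> \<open>the single cell of \<open>Row 1 h\<close> is interior now; she moves to the vertical pair in column \<open>m\<close>\<close>
  define R2 where "R2 = R1(1 := (R1 1)(h := (strip 1 m, strip 2 m)))"
  define W2 where "W2 = W1 \<union> {(1, m), (2, m)}"
  have "enclosed H (region m W1) (strip 0 (2 * h))"
    by (rule enclosed_in_strip) (use n s in \<open>auto simp: W1_def W0_def m_def\<close>)
  then have 3: "held (beats (col_beat m) R2) (region m W2)"
    unfolding R2_def
    by (intro reassign_row_cop[OF 2, where w = "strip 0 m"])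
      (use n s in \<open>auto simp: R1_def R0_def W2_def W1_def m_def\<close>)
  \<comment> \<open>column \<open>m\<close> is cleaned\<close>
  then have 4: "held (beats (col_beat (m + 1)) R2) (region (m + 1) W2)"
    by (rule conveyor) (use n in \<open>auto simp: W2_def W1_def W0_def\<close>)
  have W2: "(r, c) \<in> W2" if "r < s" "c < m + 1" for r c
  proof -
    have "r = 0 \<or> r = 1 \<or> r = 2" using that assms by auto
    then show ?thesis using that n by (auto simp: W2_def W1_def W0_def less_Suc_eq)
  qed
  \<comment> \<open>row 1 is completed while \<open>Row 0 0\<close> slides\<close>
  define R3' where "R3' = R2(0 := (R2 0)(0 := (strip 1 (m + 1), strip 0 (m + 1))))"
  define R3 where "R3 = (\<lambda>u i. if u = 1 \<and> i < h then strip_pair 1 (m + 2 + 2 * i) else R3' u i)"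
  define W3 where "W3 = W2 \<union> {1} \<times> {..<n}"
  \<comment> \<open>for \<open>h = 0\<close> this is the pair at the right end of row 0, for \<open>h > 0\<close> the first pair of the completed row\<close>
  have R200: "R2 0 0 = (strip 0 m, strip 0 (m + 1))"
    unfolding R2_def R1_def R0_def strip_pair_def m_def by simp
  have "enclosed H (region (m + 1) W2) (strip 0 m)"
    by (rule enclosed_in_strip) (use n s W2 in \<open>auto simp: W2_def W1_def\<close>)
  then have slide: "R3' u i = R2 u i \<or> enclosed H (region (m + 1) W2) (fst (R2 u i)) \<and>
      snd (R3' u i) = snd (R2 u i) \<and> legal_move H (snd (R2 u i)) (fst (R3' u i))" for u i
    using R200 s n by (auto simp: R3'_def m_def)
  have row1: "(1, c) \<in> W2 \<or> m + 2 \<le> c \<and> c < m + 2 + 2 * h \<or>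
      (\<exists>u<s. \<exists>i\<le>h. fst (R3' u i) = strip 1 c)" if "c < n" for c
  proof -
    consider "c < m + 1" | "c = m + 1" | "m + 2 \<le> c" by linarith
    then show ?thesis
    proof cases
      case 1 then show ?thesis using W2 s by auto
    next
      case 2
      then show ?thesis using s by (intro disjI2 exI[of _ 0] conjI) (auto simp: R3'_def)
    next
      case 3 then show ?thesis using that n_upper by (auto simp: m_def)
    qed
  qed
  have 5: "held (beats (col_beat (m + 1)) R3) (region (m + 1) W3)"
    unfolding R3_def W3_def
  proof (rule fill_row[OF 4])
    show "R2 1 i = strip_pair 1 (2 * i) \<and> R3' 1 i = R2 1 i" if "i < h" for i
      using that by (auto simp: R3'_def R2_def R1_def R0_def)
  qed (use n s W2 row1 slide in \<open>auto simp: m_def\<close>)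
  \<comment> \<open>row 2 is completed while \<open>Row 1 h\<close> slides\<close>
  define R4' where "R4' = R3(1 := (R3 1)(h := (strip 2 (m + 1), strip 2 m)))"
  define R4 where "R4 = (\<lambda>u i. if u = 2 \<and> i < h then strip_pair 2 (m + 2 + 2 * i) else R4' u i)"
  define W4 where "W4 = W3 \<union> {2} \<times> {..<n}"
  have R31h: "R3 1 h = (strip 1 m, strip 2 m)"
    by (auto simp: R3_def R3'_def R2_def)
  have "enclosed H (region (m + 1) W3) (strip 1 m)"
    by (rule enclosed_in_strip) (use n s W2 in \<open>auto simp: W3_def\<close>)
  then have slide: "R4' u i = R3 u i \<or> enclosed H (region (m + 1) W3) (fst (R3 u i)) \<and>
      snd (R4' u i) = snd (R3 u i) \<and> legal_move H (snd (R3 u i)) (fst (R4' u i))" for u i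
    using R31h s n by (auto simp: R4'_def m_def)
  have row2: "(2, c) \<in> W3 \<or> m + 2 \<le> c \<and> c < m + 2 + 2 * h \<or>
      (\<exists>u<s. \<exists>i\<le>h. fst (R4' u i) = strip 2 c)" if "c < n" for c
  proof -
    consider "c < m + 1" | "c = m + 1" | "m + 2 \<le> c" by linarith
    then show ?thesis
    proof cases
      case 1 then show ?thesis using W2 s by (auto simp: W3_def)
    next
      case 2
      then have "fst (R4' 1 h) = strip 2 c" by (simp add: R4'_def)
      then show ?thesis using s(2) by blast
    next
      case 3 then show ?thesis using that n_upper by (auto simp: m_def)
    qed
  qed
  have 6: "held (beats (col_beat (m + 1)) R4) (region (m + 1) W4)"
    unfolding R4_def W4_def
  proof (rule fill_row[OF 5])
    show "R3 2 i = strip_pair 2 (2 * i) \<and> R4' 2 i = R3 2 i" if "i < h" for i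
      using that by (auto simp: R4'_def R3_def R3'_def R2_def R1_def R0_def)
  qed (use n s W2 row2 slide in \<open>auto simp: m_def W3_def\<close>)
  have W4: "(r, c) \<in> W4" if "r < s" "c < n" for r c
  proof -
    have "r = 0 \<or> r = 1 \<or> r = 2" using that assms by auto
    then show ?thesis using that by (auto simp: W4_def W3_def W2_def W1_def)
  qed
  from 6 have "held (beats (col_beat n) R4) (region n W4)"
    by (rule conveyor) (use n W4 in auto)
  moreover have "region n W4 = pverts H" by (rule region_full) (use W4 in auto)
  ultimately show ?thesis by auto
qed

end

text \<open>
  The difference of \<open>4 (h (n + 1) + s (h + 1))\<close> and \<open>n\<^sup>2 + n\<close> is \<open>s (3 - s)\<close>, which is 0 or 2.
\<close>

lemma ceiling_quarter_eq:
  fixes h s n :: nat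
  assumes "n = 4 * h + s" "s \<le> 3"
  shows "\<lceil>(real n ^ 2 + real n) / 4\<rceil> = int (h * (n + 1) + s * (h + 1))"
proof -
  have "s \<in> {0, 1, 2, 3}" using assms(2) by auto
  then show ?thesis unfolding assms(1)
    by (intro ceiling_unique) (auto simp: power2_eq_square field_simps)
qed

theorem cop_number_upper_bound:
  assumes "n = 4 * h + s" "s \<le> 3"
  shows "\<exists>p. winning_strategy 0 (hamming_graph 2 n) (h * (n + 1) + s * (h + 1)) p \<and>
    weakly_monotonic 0 (hamming_graph 2 n) (h * (n + 1) + s * (h + 1)) p"
proof -
  interpret board h s n by unfold_locales (rule assms(1))
  have wf: "pair_wf_digraph H" by unfold_locales
  obtain P where "held P (pverts H)"
    using board_cleared_if_strip_le_2 board_cleared_if_strip_eq_3 assms by (cases "s \<le> 2") auto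
  from winning_of_guarded[OF wf finite_team this[unfolded held_def]]
  show ?thesis unfolding card_team .
qed

theorem theorem3p5:
  fixes n :: nat
  assumes "n \<ge> 1"
  shows "vis_cop_number 0 (hamming_graph 2 n) = mono_vis_cop_number 0 (hamming_graph 2 n)
    \<and> int (mono_vis_cop_number 0 (hamming_graph 2 n)) = \<lceil>(real n ^ 2 + real n) / 4\<rceil>"
proof -
  define h s where "h = n div 4" and "s = n mod 4"
  have hs: "n = 4 * h + s" "s \<le> 3" by (simp_all add: h_def s_def)
  define K where "K = h * (n + 1) + s * (h + 1)"
  have K: "int K = \<lceil>(real n ^ 2 + real n) / 4\<rceil>"
    unfolding K_def using ceiling_quarter_eq[OF hs] by simp
  have lower: "K \<le> k" if "winning_strategy 0 (hamming_graph 2 n) k p" for k p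
  proof -
    have "real (n^2 + n) \<le> real (4 * k)"
      using cop_number_lower_bound[OF assms that] by (simp only: of_nat_le_iff)
    then have "\<lceil>(real n ^ 2 + real n) / 4\<rceil> \<le> int k" by (simp add: ceiling_le_iff)
    then show ?thesis unfolding K[symmetric] by simp
  qed
  obtain p where p: "winning_strategy 0 (hamming_graph 2 n) K p"
    "weakly_monotonic 0 (hamming_graph 2 n) K p"
    using cop_number_upper_bound[OF hs] unfolding K_def by blast
  have "1 \<le> K" using assms hs by (cases h) (auto simp: K_def)
  have "vis_cop_number 0 (hamming_graph 2 n) = K"
    unfolding vis_cop_number_def by (rule Least_equality) (use p lower \<open>1 \<le> K\<close> in auto)
  moreover have "mono_vis_cop_number 0 (hamming_graph 2 n) = K"
    unfolding mono_vis_cop_number_def by (rule Least_equality) (use p lower \<open>1 \<le> K\<close> in auto)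
  ultimately show ?thesis using K by simp
qed

end
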